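(* Let $n\ge 5$ and let $W(n+1,n,1)$ be an $(n+1)$-web of codimension one on an $n$-dimensional manifold $X^n$, with torsion tensor $a_{\alpha\beta}$ and Pfaffian derivatives $a_{\alpha\beta\gamma}$ (as defined in the context). Suppose $W(n+1,n,1)$ is a Goursat web of the second kind, and let $\Delta_4$ be the four-dimensional distribution defined by $$(a_{14}-a_{13})\,\omega_4+(a_{15}-a_{13})\,\omega_5=0,\qquad \omega_\sigma=0,\ \ \sigma=6,\dots,n.$$ For $h=1,2,3$ put $$n_h=(a_{15}-a_{14})\,a_{13h}+(a_{13}-a_{15})\,a_{14h}+(a_{14}-a_{13})\,a_{15h}.$$ Then $\Delta_4$ is integrable if and only if the following three conditions hold: $$n_1=0,\qquad n_2=0,\qquad n_3=a_{13}\left[(a_{15}-a_{13})\,a_{34}+(a_{13}-a_{14})\,a_{35}\right].$$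
   Context: An $(n+1)$-web $W(n+1,n,1)$ on an $n$-dimensional differentiable manifold $X^n$ consists of $n+1$ foliations of codimension one, the $\xi$-th one ($\xi=1,\dots,n+1$) given by a completely integrable Pfaffian equation $\omega_\xi=0$, in general position: any $n$ of the $1$-forms $\omega_\xi$ are linearly independent at every point. The forms are normalized (by scaling) so that $\omega_1+\dots+\omega_{n+1}=0$; $\omega_1,\dots,\omega_n$ form a coframe. They satisfy the structure equations $$d\omega_\alpha=\omega_\alpha\wedge\omega+\sum_{\beta\ne\alpha}a_{\alpha\beta}\,\omega_\alpha\wedge\omega_\beta,\qquad \alpha,\beta=1,\dots,n,$$ where $\omega$ is a $1$-form and $a_{\alpha\beta}$ are functions (the torsion tensor) with $a_{\alpha\beta}=a_{\beta\alpha}$ and $\sum_{\alpha,\beta=1}^n a_{\alpha\beta}=0$; by convention $a_{\alpha\alpha}=0$. The Pfaffian derivatives $a_{\alpha\beta\gamma}$ ($\alpha\neq\beta$; $\gamma=1,\dots,n$) are the functions defined by $$da_{\alpha\beta}-a_{\alpha\beta}\,\omega=\sum_{\gamma=1}^n\left(a_{\alpha\beta\gamma}+a_{\alpha\beta}a_{\gamma\alpha}+a_{\alpha\beta}a_{\beta\gamma}\right)\omega_\gamma .$$ The web ($n\ge5$) is a Goursat web of the second kind if identically $$\begin{vmatrix}1&1&1\\ a_{13}&a_{14}&a_{15}\\ a_{23}&a_{24}&a_{25}\end{vmatrix}=0 .$$ Standing nondegeneracy assumption: the differences $a_{pa}-a_{pb}$ ($p=1,2$; $a,b\in\{3,4,5\}$,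 $a\ne b$) are nowhere zero, so that the determinant condition can equivalently be written as $\frac{a_{pa}-a_{pb}}{a_{pa}-a_{pc}}=\frac{a_{qa}-a_{qb}}{a_{qa}-a_{qc}}$ for $\{p,q\}=\{1,2\}$, $\{a,b,c\}=\{3,4,5\}$. Under these conditions, $\Delta_4$ is equally defined by $(a_{24}-a_{23})\omega_4+(a_{25}-a_{23})\omega_5=0$, $\omega_\sigma=0$. "Integrable" means completely integrable in the sense of Frobenius. *)

theory Defs
  imports "HOL-Analysis.Analysis"
begin

text \<open>The following two notions are only meant for open sets \<open>S\<close>.\<close>

primrec Ck_on :: "nat \<Rightarrow> ('e::euclidean_space \<Rightarrow> 'f::real_normed_vector) \<Rightarrow> 'e set \<Rightarrow> bool" where
  "Ck_on 0 f S \<longleftrightarrow> continuous_on S f"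
| "Ck_on (Suc k) f S \<longleftrightarrow> (\<forall>x\<in>S. f differentiable (at x)) \<and>
     (\<forall>v. Ck_on k (\<lambda>x. frechet_derivative f (at x) v) S)"

definition smooth_on :: "'e set \<Rightarrow> ('e::euclidean_space \<Rightarrow> 'f::real_normed_vector) \<Rightarrow> bool" where
  "smooth_on S f \<longleftrightarrow> (\<forall>k. Ck_on k f S)"

text \<open>A chart is a pair of its domain and its coordinate map; only the values of the
  coordinate map on the domain matter.\<close>

type_synonym ('m, 'e) chart = "'m set \<times> ('m \<Rightarrow> 'e)"

definition chart_inv :: "('m, 'e) chart \<Rightarrow> 'e \<Rightarrow> 'm" where
  "chart_inv c = inv_into (fst c) (snd c)"

definition transition :: "('m, 'e) chart \<Rightarrow> ('m, 'e) chart \<Rightarrow> 'e \<Rightarrow> 'e" where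
  "transition c d = snd d \<circ> chart_inv c"

definition is_chart :: "'m topology \<Rightarrow> ('m, 'e::euclidean_space) chart \<Rightarrow> bool" where
  "is_chart X c \<longleftrightarrow> openin X (fst c) \<and> open (snd c ` fst c) \<and>
     homeomorphic_map (subtopology X (fst c)) (top_of_set (snd c ` fst c)) (snd c)"

text \<open>The atlas need not be maximal. The dimension of the manifold is \<open>DIM('e)\<close>.\<close>

definition smooth_manifold :: "'m topology \<Rightarrow> ('m, 'e::euclidean_space) chart set \<Rightarrow> bool" where
  "smooth_manifold X A \<longleftrightarrow>
     Hausdorff_space X \<and> second_countable X \<and>
     (\<forall>c\<in>A. is_chart X c) \<and> (\<Union>c\<in>A. fst c) = topspace X \<and>
     (\<forall>c\<in>A. \<forall>d\<in>A. smooth_on (snd c ` (fst c \<inter> fst d)) (transition c d))"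

definition smooth_fun :: "('m, 'e::euclidean_space) chart set \<Rightarrow> ('m \<Rightarrow> real) \<Rightarrow> bool" where
  "smooth_fun A f \<longleftrightarrow> (\<forall>c\<in>A. smooth_on (snd c ` fst c) (f \<circ> chart_inv c))"

text \<open>Forms are given by their local representatives: \<open>\<theta> c p v\<close> is the value of the
  form \<open>\<theta>\<close> on the tangent vector at the point \<open>p\<close> whose coordinate vector in the
  chart \<open>c\<close> is \<open>v\<close>. It is meaningful only for \<open>c\<close> in the atlas and \<open>p \<in> fst c\<close>,
  and representatives in different charts are related by pullback along the transition map.\<close>

type_synonym ('m, 'e) form1 = "('m, 'e) chart \<Rightarrow> 'm \<Rightarrow> 'e \<Rightarrow> real"
type_synonym ('m, 'e) form2 = "('m, 'e) chart \<Rightarrow> 'm \<Rightarrow> 'e \<Rightarrow> 'e \<Rightarrow> real"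

definition one_form ::
    "('m, 'e::euclidean_space) chart set \<Rightarrow> ('m, 'e) form1 \<Rightarrow> bool" where
  "one_form A \<theta> \<longleftrightarrow>
     (\<forall>c\<in>A. \<forall>p\<in>fst c. linear (\<theta> c p)) \<and>
     (\<forall>c\<in>A. \<forall>v. smooth_on (snd c ` fst c) (\<lambda>x. \<theta> c (chart_inv c x) v)) \<and>
     (\<forall>c\<in>A. \<forall>d\<in>A. \<forall>p\<in>fst c \<inter> fst d. \<forall>v.
        \<theta> c p v = \<theta> d p (frechet_derivative (transition c d) (at (snd c p)) v))"

definition chart_deriv ::
    "('m, 'e::euclidean_space) chart \<Rightarrow> ('m \<Rightarrow> real) \<Rightarrow> 'm \<Rightarrow> 'e \<Rightarrow> real" where
  "chart_deriv c f p v = frechet_derivative (f \<circ> chart_inv c) (at (snd c p)) v"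

definition diff_fun :: "('m \<Rightarrow> real) \<Rightarrow> ('m, 'e::euclidean_space) form1" where
  "diff_fun f = (\<lambda>c p v. chart_deriv c f p v)"

definition ext_deriv :: "('m, 'e::euclidean_space) form1 \<Rightarrow> ('m, 'e) form2" where
  "ext_deriv \<theta> = (\<lambda>c p u v.
     chart_deriv c (\<lambda>q. \<theta> c q v) p u - chart_deriv c (\<lambda>q. \<theta> c q u) p v)"

definition wedge :: "('m, 'e) form1 \<Rightarrow> ('m, 'e) form1 \<Rightarrow> ('m, 'e) form2" where
  "wedge \<theta> \<eta> = (\<lambda>c p u v. \<theta> c p u * \<eta> c p v - \<theta> c p v * \<eta> c p u)"

text \<open>The Frobenius condition \<open>d\<theta> \<equiv> 0\<close> modulo \<open>\<Theta>\<close>, for every \<open>\<theta> \<in> \<Theta>\<close>, for the Pfaffian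
  system \<open>\<theta> = 0\<close> (\<open>\<theta> \<in> \<Theta>\<close>). It is meant for finite sets \<open>\<Theta>\<close> of one-forms that are
  linearly independent at every point; the system then defines a distribution of codimension
  \<open>card \<Theta>\<close>, and the condition depends only on that distribution.\<close>

definition completely_integrable ::
    "('m, 'e::euclidean_space) chart set \<Rightarrow> ('m, 'e) form1 set \<Rightarrow> bool" where
  "completely_integrable A \<Theta> \<longleftrightarrow>
     (\<forall>\<theta>\<in>\<Theta>. \<exists>\<psi>. (\<forall>\<eta>\<in>\<Theta>. one_form A (\<psi> \<eta>)) \<and>
        (\<forall>c\<in>A. \<forall>p\<in>fst c. \<forall>u v.
           ext_deriv \<theta> c p u v = (\<Sum>\<eta>\<in>\<Theta>. wedge (\<psi> \<eta>) \<eta> c p u v)))"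

definition indep_at ::
    "('m, 'e) chart \<Rightarrow> 'm \<Rightarrow> nat set \<Rightarrow> (nat \<Rightarrow> ('m, 'e) form1) \<Rightarrow> bool" where
  "indep_at c p J \<omega> \<longleftrightarrow>
     (\<forall>k. (\<forall>v. (\<Sum>\<xi>\<in>J. k \<xi> * \<omega> \<xi> c p v) = 0) \<longrightarrow> (\<forall>\<xi>\<in>J. k \<xi> = 0))"

definition normalized_web ::
    "('m, 'e::euclidean_space) chart set \<Rightarrow> nat \<Rightarrow> (nat \<Rightarrow> ('m, 'e) form1) \<Rightarrow> bool" where
  "normalized_web A n \<omega> \<longleftrightarrow>
     (\<forall>\<xi>\<in>{1..n+1}. one_form A (\<omega> \<xi>) \<and> completely_integrable A {\<omega> \<xi>}) \<and>
     (\<forall>c\<in>A. \<forall>p\<in>fst c. \<forall>J. J \<subseteq> {1..n+1} \<and> card J = n \<longrightarrow> indep_at c p J \<omega>) \<and>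
     (\<forall>c\<in>A. \<forall>p\<in>fst c. \<forall>v. (\<Sum>\<xi>=1..n+1. \<omega> \<xi> c p v) = 0)"

definition torsion_tensor ::
    "'m topology \<Rightarrow> ('m, 'e::euclidean_space) chart set \<Rightarrow> nat \<Rightarrow> (nat \<Rightarrow> ('m, 'e) form1) \<Rightarrow>
     ('m, 'e) form1 \<Rightarrow> (nat \<Rightarrow> nat \<Rightarrow> 'm \<Rightarrow> real) \<Rightarrow> bool" where
  "torsion_tensor X A n \<omega> \<omega>\<^sub>0 a \<longleftrightarrow>
     one_form A \<omega>\<^sub>0 \<and>
     (\<forall>\<alpha>\<in>{1..n}. \<forall>\<beta>\<in>{1..n}. smooth_fun A (a \<alpha> \<beta>)) \<and>
     (\<forall>p\<in>topspace X. \<forall>\<alpha>\<in>{1..n}. \<forall>\<beta>\<in>{1..n}. a \<alpha> \<beta> p = a \<beta> \<alpha> p) \<and>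
     (\<forall>p\<in>topspace X. \<forall>\<alpha>\<in>{1..n}. a \<alpha> \<alpha> p = 0) \<and>
     (\<forall>p\<in>topspace X. (\<Sum>\<alpha>=1..n. \<Sum>\<beta>=1..n. a \<alpha> \<beta> p) = 0) \<and>
     (\<forall>\<alpha>\<in>{1..n}. \<forall>c\<in>A. \<forall>p\<in>fst c. \<forall>u v.
        ext_deriv (\<omega> \<alpha>) c p u v =
          wedge (\<omega> \<alpha>) \<omega>\<^sub>0 c p u v +
          (\<Sum>\<beta>\<in>{1..n} - {\<alpha>}. a \<alpha> \<beta> p * wedge (\<omega> \<alpha>) (\<omega> \<beta>) c p u v))"

definition pfaffian_derivatives ::
    "('m, 'e::euclidean_space) chart set \<Rightarrow> nat \<Rightarrow> (nat \<Rightarrow> ('m, 'e) form1) \<Rightarrow>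
     ('m, 'e) form1 \<Rightarrow> (nat \<Rightarrow> nat \<Rightarrow> 'm \<Rightarrow> real) \<Rightarrow>
     (nat \<Rightarrow> nat \<Rightarrow> nat \<Rightarrow> 'm \<Rightarrow> real) \<Rightarrow> bool" where
  "pfaffian_derivatives A n \<omega> \<omega>\<^sub>0 a a' \<longleftrightarrow>
     (\<forall>\<alpha>\<in>{1..n}. \<forall>\<beta>\<in>{1..n} - {\<alpha>}.
        (\<forall>\<gamma>\<in>{1..n}. smooth_fun A (a' \<alpha> \<beta> \<gamma>)) \<and>
        (\<forall>c\<in>A. \<forall>p\<in>fst c. \<forall>v.
           diff_fun (a \<alpha> \<beta>) c p v - a \<alpha> \<beta> p * \<omega>\<^sub>0 c p v =
             (\<Sum>\<gamma>=1..n. (a' \<alpha> \<beta> \<gamma> p + a \<alpha> \<beta> p * a \<gamma> \<alpha> p + a \<alpha> \<beta> p * a \<beta> \<gamma> p) * \<omega> \<gamma> c p v)))"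

definition goursat_second_kind ::
    "'m topology \<Rightarrow> (nat \<Rightarrow> nat \<Rightarrow> 'm \<Rightarrow> real) \<Rightarrow> bool" where
  "goursat_second_kind X a \<longleftrightarrow>
     (\<forall>p\<in>topspace X.
        det (vector [vector [1, 1, 1],
                     vector [a 1 3 p, a 1 4 p, a 1 5 p],
                     vector [a 2 3 p, a 2 4 p, a 2 5 p]] :: real^3^3) = 0)"

definition goursat_nondegenerate ::
    "'m topology \<Rightarrow> (nat \<Rightarrow> nat \<Rightarrow> 'm \<Rightarrow> real) \<Rightarrow> bool" where
  "goursat_nondegenerate X a \<longleftrightarrow>
     (\<forall>p\<in>topspace X. \<forall>q\<in>{1, 2}. \<forall>i\<in>{3, 4, 5}. \<forall>j\<in>{3, 4, 5}.
        i \<noteq> j \<longrightarrow> a q i p - a q j p \<noteq> 0)"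

definition Delta4_system ::
    "nat \<Rightarrow> (nat \<Rightarrow> ('m, 'e) form1) \<Rightarrow> (nat \<Rightarrow> nat \<Rightarrow> 'm \<Rightarrow> real) \<Rightarrow> ('m, 'e) form1 set" where
  "Delta4_system n \<omega> a =
     insert (\<lambda>c p v. (a 1 4 p - a 1 3 p) * \<omega> 4 c p v + (a 1 5 p - a 1 3 p) * \<omega> 5 c p v)
            (\<omega> ` {6..n})"

definition n_coeff ::
    "(nat \<Rightarrow> nat \<Rightarrow> 'm \<Rightarrow> real) \<Rightarrow> (nat \<Rightarrow> nat \<Rightarrow> nat \<Rightarrow> 'm \<Rightarrow> real) \<Rightarrow> nat \<Rightarrow> 'm \<Rightarrow> real" where
  "n_coeff a a' h p =
     (a 1 5 p - a 1 4 p) * a' 1 3 h p + (a 1 3 p - a 1 5 p) * a' 1 4 h p +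
     (a 1 4 p - a 1 3 p) * a' 1 5 h p"

end

theory Submission
  imports Defs
begin

text \<open>
  Put \<open>P\<^sub>i = a\<^sub>1\<^sub>i - a\<^sub>1\<^sub>3\<close> for \<open>i = 4, 5\<close>. The structure equations give
  \<open>d(P\<^sub>i \<omega>\<^sub>i) = \<Sum>\<gamma>. T\<^sub>i\<^sub>\<gamma> \<omega>\<^sub>\<gamma> \<and> \<omega>\<^sub>i\<close>, the connection form cancelling. Hence modulo
  the system of \<open>\<Delta>\<^sub>4\<close> the form \<open>\<theta> = P\<^sub>4 \<omega>\<^sub>4 + P\<^sub>5 \<omega>\<^sub>5\<close> satisfies
  \<open>d\<theta> = \<Sum>\<gamma>\<le>3. \<omega>\<^sub>\<gamma> \<and> (T\<^sub>4\<^sub>\<gamma> \<omega>\<^sub>4 + T\<^sub>5\<^sub>\<gamma> \<omega>\<^sub>5)\<close>, which vanishes iff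
  \<open>T\<^sub>4\<^sub>\<gamma> P\<^sub>5 = T\<^sub>5\<^sub>\<gamma> P\<^sub>4\<close> for \<open>\<gamma> = 1, 2, 3\<close>. The difference of the two sides is
  \<open>a\<^sub>1\<^sub>3 (P\<^sub>5 a\<^sub>4\<^sub>\<gamma> - P\<^sub>4 a\<^sub>5\<^sub>\<gamma> + (P\<^sub>4 - P\<^sub>5) a\<^sub>3\<^sub>\<gamma>) - n\<^sub>\<gamma>\<close>; the bracket is zero for
  \<open>\<gamma> = 1\<close> and is the Goursat determinant up to sign for \<open>\<gamma> = 2\<close>. The equations \<open>\<omega>\<^sub>\<sigma> = 0\<close>
  impose no condition since \<open>d\<omega>\<^sub>\<sigma>\<close> is always a multiple of \<open>\<omega>\<^sub>\<sigma>\<close>.\<close>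

section \<open>Smooth functions\<close>

text \<open>Since \<open>S\<close> is open, the derivative at a point of \<open>S\<close> depends
  only on values in \<open>S\<close>; it is the same for \<open>f\<close> and \<open>g\<close>, and
  the induction passes to it.\<close>

lemma Ck_on_cong:
  assumes "open S" "Ck_on k f S" "\<And>x. x \<in> S \<Longrightarrow> f x = g x"
  shows "Ck_on k g S"
  using assms(2,3)
proof (induction k arbitrary: f g)
  case 0
  then show ?case by (simp cong: continuous_on_cong)
next
  case (Suc k)
  have D: "(g has_derivative frechet_derivative f (at x)) (at x)" if "x \<in> S" for x
    using Suc.prems that assms(1) frechet_derivative_works
      has_derivative_transform_within_open[of f _ x UNIV S g] by fastforce
  have "frechet_derivative g (at x) = frechet_derivative f (at x)" if "x \<in> S" for x
    using frechet_derivative_at[OF D[OF that]] by simp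
  with Suc.IH[of "\<lambda>x. frechet_derivative f (at x) v" for v] Suc.prems(1) D show ?case
    unfolding Ck_on.simps differentiable_def by metis
qed

lemma Ck_on_SucD: "Ck_on (Suc k) f S \<Longrightarrow> Ck_on k f S"
proof (induction k arbitrary: f)
  case 0
  then show ?case
    by (auto intro!: continuous_at_imp_continuous_on differentiable_imp_continuous_within)
next
  case (Suc k)
  then show ?case by (metis Ck_on.simps(2))
qed

text \<open>By uniqueness of derivatives any formula \<open>D\<close> may stand in for the chosen
  \<open>frechet_derivative\<close>. The closure lemmas below take \<open>D\<close> from the
  differentiation rules.\<close>

lemma Ck_on_SucI:
  assumes "open S" "\<And>x. x \<in> S \<Longrightarrow> (f has_derivative D x) (at x)"
    and "\<And>v. Ck_on k (\<lambda>x. D x v) S"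
  shows "Ck_on (Suc k) f S"
proof -
  have "D x = frechet_derivative f (at x)" if "x \<in> S" for x
    by (rule frechet_derivative_at[OF assms(2)[OF that]])
  then show ?thesis
    using assms by (auto simp: differentiable_def intro: Ck_on_cong[OF assms(1) assms(3)])
qed

lemma Ck_on_Suc_has_derivative:
  "Ck_on (Suc k) f S \<Longrightarrow> x \<in> S \<Longrightarrow> (f has_derivative frechet_derivative f (at x)) (at x)"
  using frechet_derivative_works by auto

lemma Ck_on_const: "open S \<Longrightarrow> Ck_on k (\<lambda>x. c) S"
proof (induction k arbitrary: c)
  case (Suc k)
  show ?case
    by (rule Ck_on_SucI[where D="\<lambda>x v. 0"]) (use Suc in auto)
qed auto

lemma Ck_on_add:
  assumes "open S"
  shows "Ck_on k f S \<Longrightarrow> Ck_on k g S \<Longrightarrow> Ck_on k (\<lambda>x. f x + g x) S"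
proof (induction k arbitrary: f g)
  case (Suc k)
  show ?case
    by (rule Ck_on_SucI[OF assms, OF has_derivative_add[OF
          Ck_on_Suc_has_derivative[OF Suc.prems(1)] Ck_on_Suc_has_derivative[OF Suc.prems(2)]]])
       (use Suc in auto)
qed (auto intro: continuous_on_add continuous_on_mult)

text \<open>The Leibniz rule also contains the undifferentiated factors, so the induction step needs
  \<open>f\<close> and \<open>g\<close> at level \<open>k\<close> as well, which
  \<open>Ck_on_SucD\<close> provides.\<close>

lemma Ck_on_mult:
  fixes f g :: "'e::euclidean_space \<Rightarrow> 'a::real_normed_algebra"
  assumes "open S"
  shows "Ck_on k f S \<Longrightarrow> Ck_on k g S \<Longrightarrow> Ck_on k (\<lambda>x. f x * g x) S"
proof (induction k arbitrary: f g)
  case (Suc k)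
  have "Ck_on k f S" "Ck_on k g S" using Suc.prems Ck_on_SucD by blast+
  then show ?case
    by (intro Ck_on_SucI[OF assms, OF has_derivative_mult[OF
          Ck_on_Suc_has_derivative[OF Suc.prems(1)] Ck_on_Suc_has_derivative[OF Suc.prems(2)]]]
          Ck_on_add assms Suc.IH)
       (use Suc.prems in auto)
qed (auto intro: continuous_on_add continuous_on_mult)

lemma Ck_on_inverse:
  fixes f :: "'e::euclidean_space \<Rightarrow> 'a::real_normed_div_algebra"
  assumes "open S" "\<And>x. x \<in> S \<Longrightarrow> f x \<noteq> 0"
  shows "Ck_on k f S \<Longrightarrow> Ck_on k (\<lambda>x. inverse (f x)) S"
proof (induction k)
  case (Suc k)
  have "Ck_on k (\<lambda>x. inverse (f x)) S" using Suc Ck_on_SucD by blast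
  \<comment> \<open>Negation is written as multiplication by \<open>- 1\<close>, so that closure
    under products and constants is enough.\<close>
  then have "Ck_on k (\<lambda>x. (- 1) *
      (inverse (f x) * frechet_derivative f (at x) v * inverse (f x))) S" for v
    by (intro Ck_on_mult Ck_on_const assms) (use Suc.prems in auto)
  then show ?case
    by (intro Ck_on_SucI[OF assms(1), OF Deriv.has_derivative_inverse[OF assms(2)
          Ck_on_Suc_has_derivative[OF Suc.prems]]]) auto
qed (use assms in \<open>auto intro: continuous_on_inverse\<close>)

lemma smooth_on_add:
  "open S \<Longrightarrow> smooth_on S f \<Longrightarrow> smooth_on S g \<Longrightarrow> smooth_on S (\<lambda>x. f x + g x)"
  by (simp add: smooth_on_def Ck_on_add)

lemma smooth_on_mult:
  fixes f g :: "'e::euclidean_space \<Rightarrow> 'a::real_normed_algebra"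
  shows "open S \<Longrightarrow> smooth_on S f \<Longrightarrow> smooth_on S g \<Longrightarrow> smooth_on S (\<lambda>x. f x * g x)"
  by (simp add: smooth_on_def Ck_on_mult)

lemma smooth_on_imp_differentiable:
  "smooth_on S f \<Longrightarrow> x \<in> S \<Longrightarrow> f differentiable (at x)"
  unfolding smooth_on_def by (metis Ck_on.simps(2))

section \<open>Smooth functions on an atlas with open, injective charts\<close>

locale smooth_atlas =
  fixes A :: "('m, 'e::euclidean_space) chart set"
  assumes open_image: "c \<in> A \<Longrightarrow> open (snd c ` fst c)"
    and inj_chart: "c \<in> A \<Longrightarrow> inj_on (snd c) (fst c)"
begin

lemma chart_inv_snd [simp]: "c \<in> A \<Longrightarrow> p \<in> fst c \<Longrightarrow> chart_inv c (snd c p) = p"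
  by (simp add: chart_inv_def inj_chart)

lemma chart_inv_mem: "c \<in> A \<Longrightarrow> x \<in> snd c ` fst c \<Longrightarrow> chart_inv c x \<in> fst c"
  by auto

lemma smooth_fun_const: "smooth_fun A (\<lambda>p. k)"
  by (auto simp: smooth_fun_def smooth_on_def o_def open_image Ck_on_const)

lemma smooth_fun_add:
  "smooth_fun A f \<Longrightarrow> smooth_fun A g \<Longrightarrow> smooth_fun A (\<lambda>p. f p + g p)"
  by (simp add: smooth_fun_def o_def open_image smooth_on_add)

lemma smooth_fun_mult:
  "smooth_fun A f \<Longrightarrow> smooth_fun A g \<Longrightarrow> smooth_fun A (\<lambda>p. f p * g p)"
  by (simp add: smooth_fun_def o_def open_image smooth_on_mult)

lemma smooth_fun_minus:
  assumes "smooth_fun A f" shows "smooth_fun A (\<lambda>p. - f p)"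
  using smooth_fun_mult[OF smooth_fun_const[of "-1"] assms] by simp

lemma smooth_fun_diff:
  "smooth_fun A f \<Longrightarrow> smooth_fun A g \<Longrightarrow> smooth_fun A (\<lambda>p. f p - g p)"
  using smooth_fun_add[OF _ smooth_fun_minus, of f g] by simp

lemma smooth_fun_divide:
  assumes "smooth_fun A f" "smooth_fun A g" "\<And>c p. c \<in> A \<Longrightarrow> p \<in> fst c \<Longrightarrow> g p \<noteq> 0"
  shows "smooth_fun A (\<lambda>p. f p / g p)"
proof -
  have "smooth_fun A (\<lambda>p. inverse (g p))"
    unfolding smooth_fun_def smooth_on_def o_def
  proof (intro ballI allI Ck_on_inverse open_image)
    fix c k x assume "c \<in> A"
    then show "Ck_on k (\<lambda>x. g (chart_inv c x)) (snd c ` fst c)"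
      using assms(2) by (auto simp: smooth_fun_def smooth_on_def o_def)
    show "g (chart_inv c x) \<noteq> 0" if "x \<in> snd c ` fst c"
      using assms(3) chart_inv_mem \<open>c \<in> A\<close> that by blast
  qed
  from smooth_fun_mult[OF assms(1) this] show ?thesis by (simp add: divide_inverse)
qed

section \<open>Differential forms\<close>

lemma one_form_zero: "one_form A (\<lambda>c p v. 0)"
  by (auto simp: one_form_def smooth_on_def open_image Ck_on_const linear_zero)

lemma one_formI:
  assumes "\<And>c p. c \<in> A \<Longrightarrow> p \<in> fst c \<Longrightarrow> linear (\<theta> c p)"
    and "\<And>c v. c \<in> A \<Longrightarrow> smooth_on (snd c ` fst c) (\<lambda>x. \<theta> c (chart_inv c x) v)"
    and "\<And>c d p v. c \<in> A \<Longrightarrow> d \<in> A \<Longrightarrow> p \<in> fst c \<inter> fst d \<Longrightarrow>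
      \<theta> c p v = \<theta> d p (frechet_derivative (transition c d) (at (snd c p)) v)"
  shows "one_form A \<theta>"
  using assms unfolding one_form_def by blast

lemma one_formD:
  assumes "one_form A \<theta>" "c \<in> A"
  shows "p \<in> fst c \<Longrightarrow> linear (\<theta> c p)"
    and "smooth_on (snd c ` fst c) (\<lambda>x. \<theta> c (chart_inv c x) v)"
    and "d \<in> A \<Longrightarrow> p \<in> fst c \<inter> fst d \<Longrightarrow>
      \<theta> c p v = \<theta> d p (frechet_derivative (transition c d) (at (snd c p)) v)"
  using assms unfolding one_form_def by blast+

lemma one_form_add:
  assumes "one_form A \<theta>" "one_form A \<eta>"
  shows "one_form A (\<lambda>c p v. \<theta> c p v + \<eta> c p v)"
  by (intro one_formI linear_compose_add smooth_on_add open_image arg_cong2[where f="(+)"])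
     (use one_formD[OF assms(1)] one_formD[OF assms(2)] in blast)+

lemma one_form_scale:
  assumes "smooth_fun A f" "one_form A \<theta>"
  shows "one_form A (\<lambda>c p v. f p * \<theta> c p v)"
proof (rule one_formI)
  fix c p assume "c \<in> A" "p \<in> fst c"
  with one_formD(1)[OF assms(2)] show "linear (\<lambda>v. f p * \<theta> c p v)"
    using linear_compose_scale_right[of "\<theta> c p" "f p"] by simp
next
  fix c v assume "c \<in> A"
  then show "smooth_on (snd c ` fst c) (\<lambda>x. f (chart_inv c x) * \<theta> c (chart_inv c x) v)"
    using assms(1) by (intro smooth_on_mult open_image one_formD(2)[OF assms(2)])
      (auto simp: smooth_fun_def o_def)
next
  fix c d p v assume "c \<in> A" "d \<in> A" "p \<in> fst c \<inter> fst d"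
  then show "f p * \<theta> c p v =
      f p * \<theta> d p (frechet_derivative (transition c d) (at (snd c p)) v)"
    by (intro arg_cong[where f="\<lambda>x. f p * x"] one_formD(3)[OF assms(2)])
qed

lemma one_form_sum:
  assumes "finite I" "\<And>i. i \<in> I \<Longrightarrow> smooth_fun A (f i)" "\<And>i. i \<in> I \<Longrightarrow> one_form A (\<theta> i)"
  shows "one_form A (\<lambda>c p v. \<Sum>i\<in>I. f i p * \<theta> i c p v)"
  using assms
  by (induction I) (auto intro!: one_form_zero one_form_add one_form_scale)

lemma one_form_neg:
  assumes "one_form A \<theta>" shows "one_form A (\<lambda>c p v. - \<theta> c p v)"
  using one_form_scale[OF smooth_fun_const[of "-1"] assms] by simp

text \<open>The undifferentiated factors come out at \<open>chart_inv c (snd c p)\<close>, which is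
  \<open>p\<close> because \<open>p\<close> lies in the domain of \<open>c\<close>.\<close>

lemma chart_deriv_mult:
  assumes "c \<in> A" "p \<in> fst c"
    and "(f \<circ> chart_inv c) differentiable (at (snd c p))"
    and "(g \<circ> chart_inv c) differentiable (at (snd c p))"
  shows "chart_deriv c (\<lambda>q. f q * g q) p v =
    f p * chart_deriv c g p v + chart_deriv c f p v * g p"
  using frechet_derivative_at[OF has_derivative_mult[OF
      assms(3,4)[unfolded frechet_derivative_works]], symmetric] assms(1,2)
  by (simp add: chart_deriv_def o_def)

lemma chart_deriv_add:
  assumes "(f \<circ> chart_inv c) differentiable (at (snd c p))"
    and "(g \<circ> chart_inv c) differentiable (at (snd c p))"
  shows "chart_deriv c (\<lambda>q. f q + g q) p v = chart_deriv c f p v + chart_deriv c g p v"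
  using frechet_derivative_at[OF has_derivative_add[OF
      assms[unfolded frechet_derivative_works]], symmetric]
  by (simp add: chart_deriv_def o_def)

lemma chart_deriv_diff:
  assumes "(f \<circ> chart_inv c) differentiable (at (snd c p))"
    and "(g \<circ> chart_inv c) differentiable (at (snd c p))"
  shows "chart_deriv c (\<lambda>q. f q - g q) p v = chart_deriv c f p v - chart_deriv c g p v"
  using frechet_derivative_at[OF has_derivative_diff[OF
      assms[unfolded frechet_derivative_works]], symmetric]
  by (simp add: chart_deriv_def o_def)

lemma smooth_fun_differentiable:
  "smooth_fun A f \<Longrightarrow> c \<in> A \<Longrightarrow> p \<in> fst c \<Longrightarrow>
    (f \<circ> chart_inv c) differentiable (at (snd c p))"
  unfolding smooth_fun_def by (blast intro: smooth_on_imp_differentiable)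

lemma one_form_differentiable:
  assumes "one_form A \<theta>" "c \<in> A" "p \<in> fst c"
  shows "((\<lambda>q. \<theta> c q v) \<circ> chart_inv c) differentiable (at (snd c p))"
  using assms unfolding one_form_def o_def by (blast intro: smooth_on_imp_differentiable)

lemma ext_deriv_add:
  assumes "one_form A \<theta>" "one_form A \<eta>" "c \<in> A" "p \<in> fst c"
  shows "ext_deriv (\<lambda>c p v. \<theta> c p v + \<eta> c p v) c p u v =
    ext_deriv \<theta> c p u v + ext_deriv \<eta> c p u v"
  using assms by (simp add: ext_deriv_def chart_deriv_add one_form_differentiable)

text \<open>The product rule splits each chart derivative; antisymmetrising the part that
  differentiates \<open>f\<close> gives the wedge with \<open>diff_fun f\<close>.\<close>

lemma ext_deriv_scale:
  assumes "smooth_fun A f" "one_form A \<theta>" "c \<in> A" "p \<in> fst c"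
  shows "ext_deriv (\<lambda>c p v. f p * \<theta> c p v) c p u v =
    wedge (diff_fun f) \<theta> c p u v + f p * ext_deriv \<theta> c p u v"
  using assms
  by (simp add: ext_deriv_def chart_deriv_mult one_form_differentiable
      smooth_fun_differentiable wedge_def diff_fun_def algebra_simps)

text \<open>The system is a set of forms, so summing over it needs the family to be injective,
  which can fail only when every chart domain is empty.\<close>

lemma completely_integrable_image:
  assumes "finite I"
    and inj: "\<And>c p. c \<in> A \<Longrightarrow> p \<in> fst c \<Longrightarrow> inj_on (\<lambda>i. \<eta> i c p) I"
    and ex: "\<And>i. i \<in> I \<Longrightarrow> \<exists>\<psi>. (\<forall>j\<in>I. one_form A (\<psi> j)) \<and>
      (\<forall>c\<in>A. \<forall>p\<in>fst c. \<forall>u v. ext_deriv (\<eta> i) c p u v = (\<Sum>j\<in>I. wedge (\<psi> j) (\<eta> j) c p u v))"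
  shows "completely_integrable A (\<eta> ` I)"
proof (cases "\<exists>c\<in>A. fst c \<noteq> {}")
  case True
  then have inj': "inj_on \<eta> I" using inj unfolding inj_on_def by (metis ex_in_conv)
  show ?thesis
    unfolding completely_integrable_def
  proof
    fix \<theta> assume "\<theta> \<in> \<eta> ` I"
    then obtain i where "i \<in> I" "\<theta> = \<eta> i" by auto
    from ex[OF this(1)] obtain \<psi> where \<psi>: "\<forall>j\<in>I. one_form A (\<psi> j)"
      "\<forall>c\<in>A. \<forall>p\<in>fst c. \<forall>u v. ext_deriv \<theta> c p u v = (\<Sum>j\<in>I. wedge (\<psi> j) (\<eta> j) c p u v)"
      unfolding \<open>\<theta> = \<eta> i\<close> by blast
    show "\<exists>\<psi>. (\<forall>\<eta>\<in>\<eta> ` I. one_form A (\<psi> \<eta>)) \<and>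
      (\<forall>c\<in>A. \<forall>p\<in>fst c. \<forall>u v. ext_deriv \<theta> c p u v = (\<Sum>\<eta>\<in>\<eta> ` I. wedge (\<psi> \<eta>) \<eta> c p u v))"
      \<comment> \<open>Coefficients indexed by \<open>I\<close> become coefficients indexed by the
        forms themselves through the inverse of the injective family.\<close>
      by (rule exI[of _ "\<psi> \<circ> inv_into I \<eta>"]) (use \<psi> inj' in \<open>auto simp: sum.reindex\<close>)
  qed
next
  \<comment> \<open>With all chart domains empty the pointwise identities are vacuous, so zero forms
    serve as coefficients.\<close>
  case False
  then show ?thesis
    unfolding completely_integrable_def using one_form_zero
    by (auto intro!: exI[of _ "\<lambda>_ _ _ _. 0"])
qed

end

lemma smooth_atlas_if_smooth_manifold:
  assumes "smooth_manifold X A" shows "smooth_atlas A"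
proof
  fix c assume "c \<in> A"
  then have c: "is_chart X c" using assms by (auto simp: smooth_manifold_def)
  then show "open (snd c ` fst c)" by (simp add: is_chart_def)
  have "topspace X \<inter> fst c = fst c"
    using c openin_subset unfolding is_chart_def by blast
  with c show "inj_on (snd c) (fst c)"
    by (auto simp: is_chart_def homeomorphic_map_def dest: homeomorphic_imp_injective_map)
qed

section \<open>Dual vectors\<close>

text \<open>Coefficients are indexed by \<open>I\<close> and not by the image, so that repetitions
  among the \<open>w i\<close> do no harm.\<close>

lemma span_image_eq_sum:
  assumes "finite I" "x \<in> span (w ` I)"
  shows "\<exists>k. x = (\<Sum>i\<in>I. k i *\<^sub>R w i)"
  using assms
proof (induction I arbitrary: x)
  case (insert j I)
  then obtain b where "x - b *\<^sub>R w j \<in> span (w ` I)" by (auto simp: span_insert)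
  from insert.IH[OF this] obtain k where "x - b *\<^sub>R w j = (\<Sum>i\<in>I. k i *\<^sub>R w i)" ..
  moreover have "(\<Sum>i\<in>I. (k(j := b)) i *\<^sub>R w i) = (\<Sum>i\<in>I. k i *\<^sub>R w i)"
    using insert.hyps by (intro sum.cong) auto
  ultimately show ?case
    using insert.hyps by (intro exI[of _ "k(j := b)"]) (simp add: algebra_simps)
qed auto

text \<open>Represent each form by a vector \<open>w i\<close> through the inner product. The
  component of \<open>w j\<close> orthogonal to the other representatives is killed by the other
  forms; independence makes it nonzero, and rescaling gives the value 1 at \<open>j\<close>.\<close>

lemma dual_vector_exists:
  fixes \<omega> :: "nat \<Rightarrow> ('m, 'e::euclidean_space) form1"
  assumes "finite J" "indep_at c p J \<omega>" "\<And>i. i \<in> J \<Longrightarrow> linear (\<omega> i c p)" "j \<in> J"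
  shows "\<exists>e. \<forall>i\<in>J. \<omega> i c p e = of_bool (i = j)"
proof -
  define w where "w i = adjoint (\<omega> i c p) 1" for i
  have w: "\<omega> i c p v = v \<bullet> w i" if "i \<in> J" for i v
    using adjoint_works[OF assms(3)[OF that], of v 1] by (simp add: w_def)
  obtain y z where y: "y \<in> span (w ` (J - {j}))" and yz: "w j = y + z"
    and z: "\<And>x. x \<in> span (w ` (J - {j})) \<Longrightarrow> orthogonal z x"
    using orthogonal_subspace_decomp_exists[of "w ` (J - {j})" "w j"] by metis
  have "z \<noteq> 0"
  proof
    assume "z = 0"
    with y yz span_image_eq_sum[of "J - {j}"] assms(1)
    obtain k where k: "w j = (\<Sum>i\<in>J - {j}. k i *\<^sub>R w i)" by fastforce
    \<comment> \<open>The coefficient \<open>-1\<close> at \<open>j\<close> turns the expression of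
      \<open>w j\<close> through the others into a linear relation that independence
      forbids.\<close>
    define k' where "k' = k(j := -1)"
    have "(\<Sum>i\<in>J. k' i * \<omega> i c p v) = 0" for v
    proof -
      have "(\<Sum>i\<in>J. k' i * \<omega> i c p v) = - \<omega> j c p v + (\<Sum>i\<in>J - {j}. k i * \<omega> i c p v)"
        using assms(1,4) by (subst sum.remove[of _ j]) (auto simp: k'_def)
      also have "(\<Sum>i\<in>J - {j}. k i * \<omega> i c p v) = v \<bullet> w j"
        unfolding k by (simp add: inner_sum_right w)
      finally show ?thesis using w assms(4) by simp
    qed
    then have "k' j = 0" using assms(2,4) unfolding indep_at_def by blast
    then show False by (simp add: k'_def)
  qed
  have "z \<bullet> w i = 0" if "i \<in> J" "i \<noteq> j" for i
    using z[OF span_base[of "w i"]] that by (auto simp: orthogonal_def)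
  moreover have "z \<bullet> w j = z \<bullet> z"
    using z[OF y] by (simp add: yz inner_right_distrib orthogonal_def)
  ultimately show ?thesis
    using \<open>z \<noteq> 0\<close> assms(4) w by (intro exI[of _ "z /\<^sub>R (z \<bullet> z)"]) auto
qed

section \<open>The web\<close>

text \<open>Apart from the connection term, the differential of
  \<open>x = a \<alpha> i - a \<alpha> j\<close> has \<open>\<omega> \<gamma>\<close>-coefficient
  equal to this expression plus \<open>x * a i \<gamma>\<close>. The latter is left out because it
  cancels in the exterior derivative of \<open>x * \<omega> i\<close>.\<close>

definition torsion_coeff ::
    "(nat \<Rightarrow> nat \<Rightarrow> 'm \<Rightarrow> real) \<Rightarrow> (nat \<Rightarrow> nat \<Rightarrow> nat \<Rightarrow> 'm \<Rightarrow> real) \<Rightarrow>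
     nat \<Rightarrow> nat \<Rightarrow> nat \<Rightarrow> nat \<Rightarrow> 'm \<Rightarrow> real" where
  "torsion_coeff a a' \<alpha> j i \<gamma> p =
     a' \<alpha> i \<gamma> p - a' \<alpha> j \<gamma> p + (a \<alpha> i p - a \<alpha> j p) * a \<gamma> \<alpha> p + a \<alpha> j p * (a i \<gamma> p - a j \<gamma> p)"

text \<open>With \<open>x = a \<alpha> i - a \<alpha> j\<close>, the Leibniz rule gives
  \<open>dx \<and> \<omega>\<^sub>i + x d\<omega>\<^sub>i\<close>. The connection contributes
  \<open>x \<omega>\<^sub>0 \<and> \<omega>\<^sub>i\<close> and
  \<open>x \<omega>\<^sub>i \<and> \<omega>\<^sub>0\<close>, which cancel; so do the terms in
  \<open>x * a i \<gamma>\<close>.\<close>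

lemma ext_deriv_torsion_difference:
  fixes n :: nat and \<omega> :: "nat \<Rightarrow> ('m, 'e::euclidean_space) form1"
  assumes "smooth_atlas A" "torsion_tensor X A n \<omega> \<omega>\<^sub>0 a"
    and "pfaffian_derivatives A n \<omega> \<omega>\<^sub>0 a a'"
    and "one_form A (\<omega> i)" "{\<alpha>, i, j} \<subseteq> {1..n}" "i \<noteq> \<alpha>" "j \<noteq> \<alpha>"
    and "c \<in> A" "p \<in> fst c" "p \<in> topspace X"
  shows "ext_deriv (\<lambda>c p v. (a \<alpha> i p - a \<alpha> j p) * \<omega> i c p v) c p u v =
    (\<Sum>\<gamma>=1..n. torsion_coeff a a' \<alpha> j i \<gamma> p * wedge (\<omega> \<gamma>) (\<omega> i) c p u v)"
proof -
  interpret smooth_atlas A by fact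
  have sm: "smooth_fun A (a \<alpha> i)" "smooth_fun A (a \<alpha> j)"
    using assms by (auto simp: torsion_tensor_def)
  have a0: "a i i p = 0"
    using assms by (auto simp: torsion_tensor_def)
  have d: "diff_fun (a \<alpha> k) c p v = a \<alpha> k p * \<omega>\<^sub>0 c p v +
      (\<Sum>\<gamma>=1..n. (a' \<alpha> k \<gamma> p + a \<alpha> k p * a \<gamma> \<alpha> p + a \<alpha> k p * a k \<gamma> p) * \<omega> \<gamma> c p v)"
    if "k \<in> {i, j}" for k v
  proof -
    have "\<alpha> \<in> {1..n}" "k \<in> {1..n} - {\<alpha>}" using that assms by auto
    then have "diff_fun (a \<alpha> k) c p v - a \<alpha> k p * \<omega>\<^sub>0 c p v =
      (\<Sum>\<gamma>=1..n. (a' \<alpha> k \<gamma> p + a \<alpha> k p * a \<gamma> \<alpha> p + a \<alpha> k p * a k \<gamma> p) * \<omega> \<gamma> c p v)"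
      using assms(3,8,9) unfolding pfaffian_derivatives_def by blast
    then show ?thesis by simp
  qed
  \<comment> \<open>The quadratic part is regrouped by \<open>a \<alpha> i * a i \<gamma> - a
    \<alpha> j * a j \<gamma> = (a \<alpha> i - a \<alpha> j) * a i \<gamma> + a \<alpha> j * (a i
    \<gamma> - a j \<gamma>)\<close>.\<close>
  have D: "diff_fun (\<lambda>p. a \<alpha> i p - a \<alpha> j p) c p v = (a \<alpha> i p - a \<alpha> j p) * \<omega>\<^sub>0 c p v +
      (\<Sum>\<gamma>=1..n. (torsion_coeff a a' \<alpha> j i \<gamma> p + (a \<alpha> i p - a \<alpha> j p) * a i \<gamma> p) * \<omega> \<gamma> c p v)" for v
  proof -
    have "diff_fun (\<lambda>p. a \<alpha> i p - a \<alpha> j p) c p v =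
        diff_fun (a \<alpha> i) c p v - diff_fun (a \<alpha> j) c p v"
      using sm assms(8,9) by (simp add: chart_deriv_diff smooth_fun_differentiable diff_fun_def)
    also have "\<dots> = (a \<alpha> i p - a \<alpha> j p) * \<omega>\<^sub>0 c p v +
        (\<Sum>\<gamma>=1..n. (a' \<alpha> i \<gamma> p + a \<alpha> i p * a \<gamma> \<alpha> p + a \<alpha> i p * a i \<gamma> p) * \<omega> \<gamma> c p v -
          (a' \<alpha> j \<gamma> p + a \<alpha> j p * a \<gamma> \<alpha> p + a \<alpha> j p * a j \<gamma> p) * \<omega> \<gamma> c p v)"
      by (simp add: d sum_subtractf left_diff_distrib)
    finally show ?thesis by (simp add: torsion_coeff_def algebra_simps)
  qed
  have "ext_deriv (\<omega> i) c p u v = wedge (\<omega> i) \<omega>\<^sub>0 c p u v +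
      (\<Sum>\<beta>\<in>{1..n} - {i}. a i \<beta> p * wedge (\<omega> i) (\<omega> \<beta>) c p u v)"
    using assms by (auto simp: torsion_tensor_def)
  \<comment> \<open>The added diagonal term vanishes as \<open>a i i p = 0\<close>; the range now
    matches the sum in \<open>D\<close>.\<close>
  also have "(\<Sum>\<beta>\<in>{1..n} - {i}. a i \<beta> p * wedge (\<omega> i) (\<omega> \<beta>) c p u v) =
      (\<Sum>\<beta>=1..n. a i \<beta> p * wedge (\<omega> i) (\<omega> \<beta>) c p u v)"
    by (rule sum.mono_neutral_left) (use a0 in auto)
  finally have dw: "ext_deriv (\<omega> i) c p u v = \<dots> + wedge (\<omega> i) \<omega>\<^sub>0 c p u v" by simp
  let ?W = "\<lambda>\<gamma>. wedge (\<omega> \<gamma>) (\<omega> i) c p u v" and ?x = "a \<alpha> i p - a \<alpha> j p"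
  have "wedge (diff_fun (\<lambda>p. a \<alpha> i p - a \<alpha> j p)) (\<omega> i) c p u v = ?x * wedge \<omega>\<^sub>0 (\<omega> i) c p u v +
      (\<Sum>\<gamma>=1..n. (torsion_coeff a a' \<alpha> j i \<gamma> p + ?x * a i \<gamma> p) * ?W \<gamma>)"
    by (simp add: wedge_def D right_diff_distrib distrib_right sum_distrib_right sum_subtractf mult.assoc)
  also have "\<dots> = (\<Sum>\<gamma>=1..n. torsion_coeff a a' \<alpha> j i \<gamma> p * ?W \<gamma>) -
      ?x * ((\<Sum>\<beta>=1..n. a i \<beta> p * wedge (\<omega> i) (\<omega> \<beta>) c p u v) + wedge (\<omega> i) \<omega>\<^sub>0 c p u v)"
  proof -
    have "wedge \<mu> \<nu> c p u v = - wedge \<nu> \<mu> c p u v" for \<mu> \<nu> :: "('m, 'e) form1"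
      by (simp add: wedge_def)
    from this[of "\<omega> i"] show ?thesis
      by (simp add: distrib_right sum.distrib sum_distrib_left mult.assoc right_diff_distrib sum_negf)
  qed
  finally show ?thesis
    unfolding ext_deriv_scale[OF smooth_fun_diff[OF sm] assms(4,8,9)] dw by simp
qed

theorem theorem7:
  fixes X :: "'m topology"
    and A :: "('m, 'e::euclidean_space) chart set"
    and n :: nat
    and \<omega> :: "nat \<Rightarrow> ('m, 'e) form1"
    and \<omega>\<^sub>0 :: "('m, 'e) form1"
    and a :: "nat \<Rightarrow> nat \<Rightarrow> 'm \<Rightarrow> real"
    and a' :: "nat \<Rightarrow> nat \<Rightarrow> nat \<Rightarrow> 'm \<Rightarrow> real"
  assumes "n = DIM('e)" and "n \<ge> 5"
    and "smooth_manifold X A"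
    and "normalized_web A n \<omega>"
    and "torsion_tensor X A n \<omega> \<omega>\<^sub>0 a"
    and "pfaffian_derivatives A n \<omega> \<omega>\<^sub>0 a a'"
    and "goursat_second_kind X a"
    and "goursat_nondegenerate X a"
  shows "completely_integrable A (Delta4_system n \<omega> a) \<longleftrightarrow>
    (\<forall>p\<in>topspace X. n_coeff a a' 1 p = 0) \<and>
    (\<forall>p\<in>topspace X. n_coeff a a' 2 p = 0) \<and>
    (\<forall>p\<in>topspace X. n_coeff a a' 3 p =
       a 1 3 p * ((a 1 5 p - a 1 3 p) * a 3 4 p + (a 1 3 p - a 1 4 p) * a 3 5 p))"
proof -
  interpret smooth_atlas A
    using assms(3) by (rule smooth_atlas_if_smooth_manifold)
  have top: "topspace X = (\<Union>c\<in>A. fst c)"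
    using assms(3) by (simp add: smooth_manifold_def)
  define P where "P i p = a 1 i p - a 1 3 p" for i p
  define T where "T = torsion_coeff a a' 1 3"
  define \<theta> :: "('m, 'e) form1" where
    "\<theta> = (\<lambda>c p v. P 4 p * \<omega> 4 c p v + P 5 p * \<omega> 5 c p v)"
  \<comment> \<open>Once \<open>\<omega> 4\<close> and \<open>\<omega> 5\<close> are merged into
    \<open>\<theta>\<close>, index 5 is free to carry \<open>\<theta>\<close>, so
    \<open>{5..n}\<close> indexes the whole system.\<close>
  define \<eta> where "\<eta> i = (if i = 5 then \<theta> else \<omega> i)" for i
  have \<omega>: "one_form A (\<omega> i)" if "i \<in> {1..n}" for i
    using assms(4) that by (auto simp: normalized_web_def)
  have sm_a: "smooth_fun A (a i j)" if "i \<in> {1..n}" "j \<in> {1..n}" for i j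
    using assms(5) that unfolding torsion_tensor_def by blast
  have sm_a': "smooth_fun A (a' i j k)" if "i \<in> {1..n}" "j \<in> {1..n} - {i}" "k \<in> {1..n}" for i j k
    using assms(6) that unfolding pfaffian_derivatives_def by blast
  have sm_P: "smooth_fun A (P i)" if "i \<in> {1..n}" for i
    unfolding P_def using assms(2) that by (intro smooth_fun_diff sm_a) auto
  have sm_T: "smooth_fun A (T i \<gamma>)" if "i \<in> {4, 5}" "\<gamma> \<in> {1..n}" for i \<gamma>
    unfolding T_def torsion_coeff_def using assms(2) that
    by (intro smooth_fun_add smooth_fun_diff smooth_fun_mult sm_a sm_a') auto
  have P_nz: "P i p \<noteq> 0" if "c \<in> A" "p \<in> fst c" "i \<in> {4, 5}" for c p i
  proof -
    have "p \<in> topspace X" using that top by blast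
    then show ?thesis
      using assms(8) that(3) by (auto simp: goursat_nondegenerate_def P_def)
  qed
  have dual: "\<exists>e. \<forall>i\<in>{1..n}. \<omega> i c p e = of_bool (i = j)"
    if "c \<in> A" "p \<in> fst c" "j \<in> {1..n}" for c p j
  proof (rule dual_vector_exists)
    \<comment> \<open>General position is applied to the index set that omits
      \<open>n+1\<close>.\<close>
    have "{1..n} \<subseteq> {1..n+1} \<and> card {1..n} = n" by auto
    then show "indep_at c p {1..n} \<omega>"
      using assms(4) that unfolding normalized_web_def by blast
  qed (use one_formD(1)[OF \<omega>] that in auto)
  have d\<theta>: "ext_deriv \<theta> c p u v = (\<Sum>\<gamma>=1..n. T 4 \<gamma> p * wedge (\<omega> \<gamma>) (\<omega> 4) c p u v +
      T 5 \<gamma> p * wedge (\<omega> \<gamma>) (\<omega> 5) c p u v)" if "c \<in> A" "p \<in> fst c" for c p u v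
  proof -
    have "one_form A (\<lambda>c p v. P i p * \<omega> i c p v)" if "i \<in> {4, 5}" for i
      using that assms(2) by (intro one_form_scale sm_P \<omega>) auto
    moreover have "ext_deriv (\<lambda>c p v. P i p * \<omega> i c p v) c p u v =
        (\<Sum>\<gamma>=1..n. T i \<gamma> p * wedge (\<omega> \<gamma>) (\<omega> i) c p u v)" if "i \<in> {4, 5}" for i
      unfolding P_def T_def using that assms(2) \<open>c \<in> A\<close> \<open>p \<in> fst c\<close> top
      by (intro ext_deriv_torsion_difference[OF smooth_atlas_axioms assms(5,6) \<omega>]) auto
    ultimately show ?thesis
      unfolding \<theta>_def by (simp add: ext_deriv_add that sum.distrib)
  qed
  have system: "Delta4_system n \<omega> a = \<eta> ` {5..n}"
  proof -
    have "Delta4_system n \<omega> a = insert \<theta> (\<omega> ` {6..n})"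
      by (simp add: Delta4_system_def \<theta>_def P_def)
    also have "\<dots> = \<eta> ` insert 5 {6..n}"
      by (auto simp: \<eta>_def image_iff)
    also have "insert 5 {6..n} = {5..n}"
      using assms(2) by auto
    finally show ?thesis .
  qed
  have K: "T 4 \<gamma> p * P 5 p - T 5 \<gamma> p * P 4 p =
      a 1 3 p * (P 5 p * a 4 \<gamma> p - P 4 p * a 5 \<gamma> p + (P 4 p - P 5 p) * a 3 \<gamma> p) -
      n_coeff a a' \<gamma> p" for \<gamma> p
    by (simp add: T_def torsion_coeff_def P_def n_coeff_def algebra_simps)
  have K123: "T 4 1 p * P 5 p - T 5 1 p * P 4 p = - n_coeff a a' 1 p"
    "T 4 2 p * P 5 p - T 5 2 p * P 4 p = - n_coeff a a' 2 p"
    "T 4 3 p * P 5 p - T 5 3 p * P 4 p =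
       a 1 3 p * ((a 1 5 p - a 1 3 p) * a 3 4 p + (a 1 3 p - a 1 4 p) * a 3 5 p) -
       n_coeff a a' 3 p"
    if "p \<in> topspace X" for p
  proof -
    have sym: "a i j p = a j i p" if "i \<in> {1..n}" "j \<in> {1..n}" for i j
      using assms(5) that \<open>p \<in> topspace X\<close> unfolding torsion_tensor_def by blast
    have s: "a 3 1 p = a 1 3 p" "a 4 1 p = a 1 4 p" "a 5 1 p = a 1 5 p"
      "a 3 2 p = a 2 3 p" "a 4 2 p = a 2 4 p" "a 5 2 p = a 2 5 p"
      "a 4 3 p = a 3 4 p" "a 5 3 p = a 3 5 p"
      by (rule sym; use assms(2) in simp)+
    \<comment> \<open>For \<gamma> = 3 this leaves \<open>P 5 p * a 3 4 p - P 4 p * a 3 5 p\<close>,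
      the bracket of the third condition.\<close>
    have "a 3 3 p = 0"
      using assms(2,5) that by (auto simp: torsion_tensor_def)
    moreover have "P 5 p * a 2 4 p - P 4 p * a 2 5 p + (P 4 p - P 5 p) * a 2 3 p = 0"
      using assms(7) that by (auto simp: goursat_second_kind_def det_3 P_def algebra_simps)
    ultimately show "T 4 1 p * P 5 p - T 5 1 p * P 4 p = - n_coeff a a' 1 p"
      "T 4 2 p * P 5 p - T 5 2 p * P 4 p = - n_coeff a a' 2 p"
      "T 4 3 p * P 5 p - T 5 3 p * P 4 p =
         a 1 3 p * ((a 1 5 p - a 1 3 p) * a 3 4 p + (a 1 3 p - a 1 4 p) * a 3 5 p) -
         n_coeff a a' 3 p"
      unfolding K s by (simp_all add: P_def algebra_simps)
  qed
  have "completely_integrable A (\<eta> ` {5..n}) \<longleftrightarrow>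
    (\<forall>p\<in>topspace X. \<forall>\<gamma>\<in>{1..3}. T 4 \<gamma> p * P 5 p = T 5 \<gamma> p * P 4 p)"
  proof (intro iffI ballI)
    fix p \<gamma>
    assume CI: "completely_integrable A (\<eta> ` {5..n})"
      and "p \<in> topspace X" and \<gamma>: "\<gamma> \<in> {1..3::nat}"
    then obtain c where c: "c \<in> A" "p \<in> fst c" unfolding top by blast
    have "\<theta> \<in> \<eta> ` {5..n}" using assms(2) by (intro image_eqI[of _ _ 5]) (auto simp: \<eta>_def)
    from CI[unfolded completely_integrable_def, rule_format, OF this]
    obtain \<psi> where "\<forall>c\<in>A. \<forall>p\<in>fst c. \<forall>u v.
        ext_deriv \<theta> c p u v = (\<Sum>\<zeta>\<in>\<eta> ` {5..n}. wedge (\<psi> \<zeta>) \<zeta> c p u v)"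
      by (elim exE conjE)
    from this[rule_format, OF c] have \<psi>: "ext_deriv \<theta> c p u v =
        (\<Sum>\<zeta>\<in>\<eta> ` {5..n}. wedge (\<psi> \<zeta>) \<zeta> c p u v)" for u v .
    obtain e where e: "\<And>i j. j \<in> {1..n} \<Longrightarrow> i \<in> {1..n} \<Longrightarrow> \<omega> i c p (e j) = of_bool (i = j)"
      using dual[OF c] by metis
    \<comment> \<open>\<open>v\<close> is killed by \<open>\<theta>\<close> and by every
      \<open>\<omega> i\<close> with \<open>i \<ge> 6\<close>; together with \<open>e 1\<close>,
      \<open>e 2\<close>, \<open>e 3\<close> it spans \<Delta>4 at \<open>p\<close>. The required
      equations are the values of \<open>ext_deriv \<theta>\<close> on the pairs
      \<open>e \<gamma>\<close>, \<open>v\<close>.\<close>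
    define v where "v = P 5 p *\<^sub>R e 4 - P 4 p *\<^sub>R e 5"
    have v: "\<omega> i c p v = P 5 p * of_bool (i = 4) - P 4 p * of_bool (i = 5)" if "i \<in> {1..n}" for i
      using one_formD(1)[OF \<omega>[OF that] c] e that assms(2)
      by (simp add: v_def linear_diff linear_scale)
    have "wedge (\<psi> \<zeta>) \<zeta> c p (e \<gamma>) v = 0" if "\<zeta> \<in> \<eta> ` {5..n}" for \<zeta>
    proof -
      have "\<zeta> c p (e \<gamma>) = 0 \<and> \<zeta> c p v = 0"
        using that v e \<gamma> assms(2) by (auto simp: \<eta>_def \<theta>_def split: if_splits)
      then show ?thesis by (simp add: wedge_def)
    qed
    then have "0 = ext_deriv \<theta> c p (e \<gamma>) v"
      unfolding \<psi> by (intro sum.neutral[symmetric] ballI)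
    \<comment> \<open>As \<gamma> is at most 3, \<open>e \<gamma>\<close> is killed by
      \<open>\<omega> 4\<close> and \<open>\<omega> 5\<close>. Only the products of
      \<open>\<omega> i\<close> at \<open>e \<gamma>\<close> with \<open>\<omega> 4\<close> or
      \<open>\<omega> 5\<close> at \<open>v\<close> survive, and those two values at
      \<open>v\<close> are \<open>P 5 p\<close> and \<open>- P 4 p\<close>.\<close>
    also have "\<dots> = (\<Sum>i=1..n. if i = \<gamma> then T 4 i p * P 5 p - T 5 i p * P 4 p else 0)"
      unfolding d\<theta>[OF c] wedge_def
      by (rule sum.cong) (use v e \<gamma> assms(2) in auto)
    also have "\<dots> = T 4 \<gamma> p * P 5 p - T 5 \<gamma> p * P 4 p"
      using \<gamma> assms(2) by simp
    finally show "T 4 \<gamma> p * P 5 p = T 5 \<gamma> p * P 4 p" by simp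
  next
    assume proportional: "\<forall>p\<in>topspace X. \<forall>\<gamma>\<in>{1..3}. T 4 \<gamma> p * P 5 p = T 5 \<gamma> p * P 4 p"
    show "completely_integrable A (\<eta> ` {5..n})"
    proof (rule completely_integrable_image)
      fix c p assume c: "c \<in> A" "p \<in> fst c"
      show "inj_on (\<lambda>i. \<eta> i c p) {5..n}"
      proof (rule linorder_inj_onI)
        \<comment> \<open>Here \<open>j\<close> is at least 6, so \<open>\<eta> j\<close> is
          \<open>\<omega> j\<close>. Its dual vector is killed by \<open>\<eta> i\<close>, even when
          that is \<open>\<theta>\<close>, since \<open>\<theta>\<close> involves only indices 4 and
          5.\<close>
        fix i j assume "i < j" "i \<in> {5..n}" "j \<in> {5..n}"
        moreover from this obtain e where "\<forall>i\<in>{1..n}. \<omega> i c p e = of_bool (i = j)"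
          using dual[OF c, of j] by auto
        ultimately have "\<eta> i c p e = 0" "\<eta> j c p e = 1"
          by (auto simp: \<eta>_def \<theta>_def)
        then show "\<eta> i c p \<noteq> \<eta> j c p" by auto
      qed auto
    next
      fix i assume i: "i \<in> {5..n}"
      show "\<exists>\<psi>. (\<forall>j\<in>{5..n}. one_form A (\<psi> j)) \<and> (\<forall>c\<in>A. \<forall>p\<in>fst c. \<forall>u v.
          ext_deriv (\<eta> i) c p u v = (\<Sum>j\<in>{5..n}. wedge (\<psi> j) (\<eta> j) c p u v))"
      proof (cases "i = 5")
        case False
        \<comment> \<open>The structure equation has \<open>\<omega> i\<close> as left factor in
          every term; moving it to the right gives the minus sign and leaves a single nonzero
          coefficient.\<close>
        define \<psi> where "\<psi> j = (if j = i
          then (\<lambda>c p v. - (\<omega>\<^sub>0 c p v + (\<Sum>\<beta>\<in>{1..n} - {i}. a i \<beta> p * \<omega> \<beta> c p v)))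
          else (\<lambda>c p v. 0))" for j
        have "one_form A \<omega>\<^sub>0" using assms(5) by (simp add: torsion_tensor_def)
        then have "one_form A (\<lambda>c p v. - (\<omega>\<^sub>0 c p v + (\<Sum>\<beta>\<in>{1..n} - {i}. a i \<beta> p * \<omega> \<beta> c p v)))"
          using i by (intro one_form_neg one_form_add one_form_sum sm_a \<omega>) auto
        then have "one_form A (\<psi> j)" for j
          by (simp only: \<psi>_def one_form_zero simp_thms split: if_split)
        moreover have "ext_deriv (\<eta> i) c p u v = (\<Sum>j\<in>{5..n}. wedge (\<psi> j) (\<eta> j) c p u v)"
          if "c \<in> A" "p \<in> fst c" for c p u v
        proof -
          have "ext_deriv (\<eta> i) c p u v = wedge (\<omega> i) \<omega>\<^sub>0 c p u v +
              (\<Sum>\<beta>\<in>{1..n} - {i}. a i \<beta> p * wedge (\<omega> i) (\<omega> \<beta>) c p u v)"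
            using assms(5) that i False by (auto simp: torsion_tensor_def \<eta>_def)
          also have "\<dots> = wedge (\<psi> i) (\<eta> i) c p u v"
            using False by (simp add: \<psi>_def \<eta>_def wedge_def algebra_simps sum_distrib_left
                sum_distrib_right flip: sum.distrib sum_subtractf)
          also have "\<dots> = (\<Sum>j\<in>{5..n}. wedge (\<psi> j) (\<eta> j) c p u v)"
            using i by (subst sum.remove[of _ i]) (auto simp: wedge_def \<psi>_def intro!: sum.neutral)
          finally show ?thesis .
        qed
        ultimately show ?thesis by blast
      next
        case True
        \<comment> \<open>For \<gamma> at most 3, proportionality makes
          \<open>T 4 \<gamma> / P 4\<close> equal to \<open>T 5 \<gamma> / P 5\<close>, so the two
          terms with \<open>\<omega> \<gamma>\<close> combine into a wedge with
          \<open>\<theta>\<close>. The remaining multiple of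
          \<open>\<omega>\<^sub>4 \<and> \<omega>\<^sub>5\<close> has coefficient
          \<open>T 5 4 - T 4 5\<close>; since \<open>\<omega>\<^sub>4 \<and> \<theta> = P\<^sub>5
          \<omega>\<^sub>4 \<and> \<omega>\<^sub>5\<close>, division by \<open>P 5\<close> absorbs
          it.\<close>
        define k where "k \<gamma> p = (if \<gamma> = 4 then (T 5 4 p - T 4 5 p) / P 5 p
          else T 4 \<gamma> p / P 4 p)" for \<gamma> p
        \<comment> \<open>For \<open>j \<ge> 6\<close> the terms of
          \<open>ext_deriv \<theta>\<close> with \<open>\<omega> j\<close> as left factor are
          collected; the minus sign comes from moving that factor to the right.\<close>
        define \<psi> where "\<psi> j = (if j = 5 then (\<lambda>c p v. \<Sum>\<gamma>\<in>{1..4}. k \<gamma> p * \<omega> \<gamma> c p v)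
          else (\<lambda>c p v. - (\<Sum>\<gamma>\<in>{4, 5}. T \<gamma> j p * \<omega> \<gamma> c p v)))" for j
        have "smooth_fun A (k \<gamma>)" if "\<gamma> \<in> {1..4}" for \<gamma>
        proof (cases "\<gamma> = 4")
          case True
          then have "k \<gamma> = (\<lambda>p. (T 5 4 p - T 4 5 p) / P 5 p)" by (simp add: k_def fun_eq_iff)
          moreover have "smooth_fun A \<dots>"
            using assms(2) P_nz by (intro smooth_fun_divide smooth_fun_diff sm_T sm_P) auto
          ultimately show ?thesis by simp
        next
          case False
          then have "k \<gamma> = (\<lambda>p. T 4 \<gamma> p / P 4 p)" by (simp add: k_def fun_eq_iff)
          moreover have "smooth_fun A \<dots>"
            using assms(2) P_nz that by (intro smooth_fun_divide sm_T sm_P) auto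
          ultimately show ?thesis by simp
        qed
        then have "one_form A (\<lambda>c p v. \<Sum>\<gamma>\<in>{1..4}. k \<gamma> p * \<omega> \<gamma> c p v)"
          using assms(2) by (intro one_form_sum \<omega>) auto
        moreover have "one_form A (\<lambda>c p v. - (\<Sum>\<gamma>\<in>{4, 5}. T \<gamma> j p * \<omega> \<gamma> c p v))"
          if "j \<in> {5..n}" for j
          using assms(2) that by (intro one_form_neg one_form_sum sm_T \<omega>) auto
        ultimately have "one_form A (\<psi> j)" if "j \<in> {5..n}" for j
          using that by (simp only: \<psi>_def simp_thms split: if_split)
        moreover have "ext_deriv \<theta> c p u v = (\<Sum>j\<in>{5..n}. wedge (\<psi> j) (\<eta> j) c p u v)"
          if c: "c \<in> A" "p \<in> fst c" for c p u v
        proof -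
          let ?W = "\<lambda>\<gamma>. T 4 \<gamma> p * wedge (\<omega> \<gamma>) (\<omega> 4) c p u v + T 5 \<gamma> p * wedge (\<omega> \<gamma>) (\<omega> 5) c p u v"
          have nz: "P 4 p \<noteq> 0" "P 5 p \<noteq> 0" using P_nz[OF c] by auto
          have "p \<in> topspace X" using c top by blast
          then have T: "T 4 \<gamma> p = k \<gamma> p * P 4 p" "T 5 \<gamma> p = k \<gamma> p * P 5 p" if "\<gamma> \<in> {1..3}" for \<gamma>
            using proportional that nz by (auto simp: k_def field_simps)
          have T54: "T 5 4 p = T 4 5 p + k 4 p * P 5 p" using nz by (simp add: k_def)
          \<comment> \<open>Indices up to 5 together form the wedge with \<open>\<theta>\<close>;
            those from 6 on match the other forms of the system term by term.\<close>
          have "{1..n} = {1..5} \<union> {6..n}" using assms(2) by auto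
          then have "ext_deriv \<theta> c p u v = (\<Sum>\<gamma>=1..5. ?W \<gamma>) + (\<Sum>\<gamma>=6..n. ?W \<gamma>)"
            unfolding d\<theta>[OF c] by (simp add: sum.union_disjoint)
          also have "(\<Sum>\<gamma>=6..n. ?W \<gamma>) = (\<Sum>j=6..n. wedge (\<psi> j) (\<eta> j) c p u v)"
            by (rule sum.cong) (auto simp: wedge_def \<psi>_def \<eta>_def algebra_simps)
          also have "(\<Sum>\<gamma>=1..5. ?W \<gamma>) = wedge (\<psi> 5) (\<eta> 5) c p u v"
          proof -
            have I: "{1..5} = {1, 2, 3, 4, 5::nat}" "{1..4} = {1, 2, 3, 4::nat}" by auto
            show ?thesis
              unfolding I \<psi>_def \<eta>_def \<theta>_def wedge_def by (simp add: T T54 algebra_simps)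
          qed
          also have "\<dots> + (\<Sum>j=6..n. wedge (\<psi> j) (\<eta> j) c p u v) =
              (\<Sum>j\<in>{5..n}. wedge (\<psi> j) (\<eta> j) c p u v)"
            using assms(2) by (simp add: sum.atLeast_Suc_atMost)
          finally show ?thesis .
        qed
        moreover have "\<eta> i = \<theta>" using True by (simp add: \<eta>_def)
        ultimately show ?thesis by (intro exI[of _ \<psi>]) simp
      qed
    qed simp
  qed
  moreover have "(\<forall>\<gamma>\<in>{1..3}. T 4 \<gamma> p * P 5 p = T 5 \<gamma> p * P 4 p) \<longleftrightarrow>
      n_coeff a a' 1 p = 0 \<and> n_coeff a a' 2 p = 0 \<and> n_coeff a a' 3 p =
        a 1 3 p * ((a 1 5 p - a 1 3 p) * a 3 4 p + (a 1 3 p - a 1 4 p) * a 3 5 p)"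
    if "p \<in> topspace X" for p
  proof -
    have "{1..3} = {1, 2, 3::nat}" by auto
    then show ?thesis using K123[OF that] by auto
  qed
  ultimately show ?thesis
    unfolding system by blast
qed

end
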